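(* Let $F_1\in\mathbb{R}^{n\times n}$, $F_2\in\mathbb{R}^{n\times n^2}$, let $x:I\to\mathbb{R}^n$ be a solution of the quadratic system $x'=F_1x+F_2x^{[2]}$ with $x(0)=x_0$, and let $$\beta_0:=\frac{\|x_0\|\,\|F_2\|}{\|F_1\|}.$$ Then the error $\varepsilon(t)=x(t)-\hat x(t)$ on the solution obtained by Carleman linearization truncated at order $N$ satisfies the estimate $$\|\varepsilon(t)\|\le\mathcal{E}_2(t):=\frac{\|x_0\|e^{\|F_1\|t}}{(1+\beta_0)-\beta_0e^{\|F_1\|t}}\left[\beta_0\bigl(e^{\|F_1\|t}-1\bigr)\right]^N.$$ Moreover, for all $0<t<T^*$, where $$T^*:=\frac{1}{\|F_1\|}\ln\left(1+\frac1{\beta_0}\right),$$ the solution of the truncated system converges, that is, $\lim_{N\to\infty}\|\varepsilon(t)\|=0$ for all $t<T^*$.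
   Context: $I\subseteq[0,\infty)$ is a time interval with $0\in I$. $\|\cdot\|$ is the supremum norm on $\mathbb{R}^n$, and for matrices the induced norm $\|A\|=\max_i\sum_j|a_{ij}|$. $x^{[i]}=x\otimes\cdots\otimes x$ ($i$ factors) is the Kronecker power, a vector in $\mathbb{R}^{n^i}$. Transfer matrices: for $i\ge1$ and $j\in\{1,2\}$, $A^i_{i+j-1}:=\sum_{\nu=1}^{i}\mathbb{I}_n^{\otimes(\nu-1)}\otimes F_j\otimes\mathbb{I}_n^{\otimes(i-\nu)}\in\mathbb{R}^{n^i\times n^{i+j-1}}$, where $\mathbb{I}_n$ is the $n\times n$ identity matrix. If $x$ solves the ODE, then $y_i:=x^{[i]}$ satisfies $y_i'=A^i_iy_i+A^i_{i+1}y_{i+1}$ for all $i\ge1$. The Carleman linearization truncated at order $N\ge1$ is the finite linear system with unknowns $\hat y_i(t)\in\mathbb{R}^{n^i}$, $1\le i\le N$: $\hat y_i'=A^i_i\hat y_i+A^i_{i+1}\hat y_{i+1}$ for $1\le i<N$, $\hat y_N'=A^N_N\hat y_N$, with $\hat y_i(0)=x_0^{[i]}$. Its approximation of $x$ is $\hat x:=\hat y_1$, which depends on $N$.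
   Formalization: The estimate is stated only for t in I with t < T* (T* = ∞ if β₀ = 0), since at T* the denominator of E₂ vanishes and for t > T* E₂(t) is negative; ‖F₁‖ ≠ 0 and n ≥ 1 are made explicit. *)

theory Defs
  imports "HOL-Analysis.Analysis" "Jordan_Normal_Form.Matrix"
begin

unbundle no vec_syntax

text \<open>The dimensions $n^i$ depend on a running index, so vectors and matrices are the
  carrier-based ones of Jordan_Normal_Form. Both norms below are only meaningful for nonempty
  dimensions (Max of the empty set is unspecified).\<close>

definition sup_norm_vec :: "real vec \<Rightarrow> real" where
  "sup_norm_vec v = Max ((\<lambda>i. \<bar>v $ i\<bar>) ` {..<dim_vec v})"

definition sup_norm_mat :: "real mat \<Rightarrow> real" where
  "sup_norm_mat A = Max ((\<lambda>i. \<Sum>j<dim_col A. \<bar>A $$ (i, j)\<bar>) ` {..<dim_row A})"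

definition kron_vec :: "real vec \<Rightarrow> real vec \<Rightarrow> real vec" where
  "kron_vec u v = vec (dim_vec u * dim_vec v)
     (\<lambda>k. u $ (k div dim_vec v) * v $ (k mod dim_vec v))"

definition kron_mat :: "real mat \<Rightarrow> real mat \<Rightarrow> real mat" where
  "kron_mat A B = mat (dim_row A * dim_row B) (dim_col A * dim_col B)
     (\<lambda>(r, c). A $$ (r div dim_row B, c div dim_col B) * B $$ (r mod dim_row B, c mod dim_col B))"

fun kron_pow_vec :: "real vec \<Rightarrow> nat \<Rightarrow> real vec" where
  "kron_pow_vec x 0 = vec 1 (\<lambda>_. 1)"
| "kron_pow_vec x (Suc i) = kron_vec x (kron_pow_vec x i)"

fun kron_pow_mat :: "real mat \<Rightarrow> nat \<Rightarrow> real mat" where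
  "kron_pow_mat A 0 = 1\<^sub>m 1"
| "kron_pow_mat A (Suc i) = kron_mat A (kron_pow_mat A i)"

text \<open>For \<open>F = F\<^sub>j\<close> this is $A^i_{i+j-1}$. The sum of matrices is taken entrywise, as the type of
  matrices of all sizes has no zero element.\<close>

definition transfer_mat :: "nat \<Rightarrow> real mat \<Rightarrow> nat \<Rightarrow> nat \<Rightarrow> real mat" where
  "transfer_mat n F j i = mat (n ^ i) (n ^ (i + j - 1)) (\<lambda>(r, c).
     \<Sum>\<nu>=1..i. kron_mat (kron_mat (kron_pow_mat (1\<^sub>m n) (\<nu> - 1)) F)
                       (kron_pow_mat (1\<^sub>m n) (i - \<nu>)) $$ (r, c))"

text \<open>The derivative is relative to the interval, hence one-sided at its endpoints.\<close>

definition has_vec_deriv :: "(real \<Rightarrow> real vec) \<Rightarrow> real vec \<Rightarrow> real \<Rightarrow> real set \<Rightarrow> bool" where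
  "has_vec_deriv y d t I \<longleftrightarrow> dim_vec (y t) = dim_vec d \<and>
     (\<forall>k<dim_vec d. ((\<lambda>s. y s $ k) has_real_derivative d $ k) (at t within I))"

definition quadratic_ode_solution ::
  "nat \<Rightarrow> real mat \<Rightarrow> real mat \<Rightarrow> real vec \<Rightarrow> real set \<Rightarrow> (real \<Rightarrow> real vec) \<Rightarrow> bool" where
  "quadratic_ode_solution n F1 F2 x0 I x \<longleftrightarrow>
     (\<forall>t\<in>I. x t \<in> carrier_vec n) \<and> x 0 = x0 \<and>
     (\<forall>t\<in>I. has_vec_deriv x (F1 *\<^sub>v x t + F2 *\<^sub>v kron_pow_vec (x t) 2) t I)"

definition carleman_solution ::
  "nat \<Rightarrow> real mat \<Rightarrow> real mat \<Rightarrow> real vec \<Rightarrow> real set \<Rightarrow> nat \<Rightarrow> (nat \<Rightarrow> real \<Rightarrow> real vec) \<Rightarrow> bool" where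
  "carleman_solution n F1 F2 x0 I N y \<longleftrightarrow>
     (\<forall>i\<in>{1..N}. (\<forall>t\<in>I. y i t \<in> carrier_vec (n ^ i)) \<and> y i 0 = kron_pow_vec x0 i) \<and>
     (\<forall>i\<in>{1..<N}. \<forall>t\<in>I. has_vec_deriv (y i)
        (transfer_mat n F1 1 i *\<^sub>v y i t + transfer_mat n F2 2 i *\<^sub>v y (i + 1) t) t I) \<and>
     (\<forall>t\<in>I. has_vec_deriv (y N) (transfer_mat n F1 1 N *\<^sub>v y N t) t I)"

definition carleman_beta0 :: "real mat \<Rightarrow> real mat \<Rightarrow> real vec \<Rightarrow> real" where
  "carleman_beta0 F1 F2 x0 = sup_norm_vec x0 * sup_norm_mat F2 / sup_norm_mat F1"

definition carleman_E2 :: "real mat \<Rightarrow> real mat \<Rightarrow> real vec \<Rightarrow> nat \<Rightarrow> real \<Rightarrow> real" where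
  "carleman_E2 F1 F2 x0 N t =
     (let a = sup_norm_mat F1; \<beta>0 = carleman_beta0 F1 F2 x0 in
        sup_norm_vec x0 * exp (a * t) / ((1 + \<beta>0) - \<beta>0 * exp (a * t))
        * (\<beta>0 * (exp (a * t) - 1)) ^ N)"

text \<open>Extended-real valued, so that $1/\beta_0$, and with it $T^*$, is $\infty$ when
  $\beta_0 = 0$.\<close>

definition carleman_Tstar :: "real mat \<Rightarrow> real mat \<Rightarrow> real vec \<Rightarrow> ereal" where
  "carleman_Tstar F1 F2 x0 =
     (let \<beta>0 = carleman_beta0 F1 F2 x0 in
        if \<beta>0 = 0 then \<infinity> else ereal (1 / sup_norm_mat F1 * ln (1 + 1 / \<beta>0)))"

end

theory Submission
  imports Defs
begin

text \<open>Write \<open>a = \<parallel>F\<^sub>1\<parallel>\<close>, \<open>b = \<parallel>F\<^sub>2\<parallel>\<close>, \<open>u\<^sub>0 = \<parallel>x\<^sub>0\<parallel>\<close>. The proof compares the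
  whole problem, truncation included, with the scalar equation \<open>u' = a u + b u\<^sup>2\<close>,
  \<open>u(0) = u\<^sub>0\<close>: the error of the system is at most the error of the Carleman truncation of the
  scalar equation, and the latter is known in closed form and equals $\mathcal{E}_2$.

  \<^emph>\<open>Scalar side.\<close> With \<open>w(t) = \<beta>\<^sub>0 (e\<^sup>a\<^sup>t - 1)\<close> the solution is
  \<open>u = u\<^sub>0 e\<^sup>a\<^sup>t / (1 - w)\<close>, which exists as long as \<open>w < 1\<close>, that is, for $t < T^*$. By the
  binomial series its powers are $u^i = u_0^i e^{iat} \sum_k \binom{i+k-1}{k} w^k$, and keeping only
  the terms with \<open>k \<le> N - i\<close> gives the solution $\hat u_i$ of the truncated scalar system
  (lemma \<open>truncated_deriv\<close>). For \<open>i = 1\<close> this is a geometric series, and its tail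
  $u - \hat u_1$ is exactly $\mathcal{E}_2$ (lemma \<open>u_minus_truncated_one\<close>).

  \<^emph>\<open>Vector side.\<close> The Kronecker powers of \<open>x\<close> satisfy the infinite Carleman system
  (lemma \<open>kron_pow_solution_has_derivative\<close>), and a transfer matrix of level \<open>i\<close> built from \<open>F\<close>
  has norm at most \<open>i \<parallel>F\<parallel>\<close> (lemma \<open>abs_row_sum_transfer_mat\<close>). The errors
  $\varepsilon_i = x^{[i]} - \hat y_i$ therefore start at zero and satisfy
  $\varepsilon_i' = A^i_i \varepsilon_i + A^i_{i+1} \varepsilon_{i+1}$ for \<open>i \<le> N\<close>, when
  $\hat y_{N+1} = 0$ is put on top; the scalar errors $u^i - \hat u_i$ satisfy
  the same system with the matrices replaced by the bounds \<open>i a\<close> and \<open>i b\<close> of their norms.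

  \<^emph>\<open>Comparison.\<close> A differential inequality for the components of a vector (lemma
  \<open>comparison_principle\<close>) is used twice: for the nonlinear equation it gives
  \<open>\<parallel>x\<parallel> \<le> u\<close> (lemma \<open>solution_le_majorant\<close>), hence the bound at level \<open>N + 1\<close>, and for the
  linear error equations it carries the bound from level \<open>i + 1\<close> to level \<open>i\<close>
  (lemma \<open>carleman_error_le_majorant\<close>), down to level \<open>1\<close>. The convergence
  follows because $\mathcal{E}_2$ is a constant times \<open>w\<^sup>N\<close>.\<close>

section \<open>Kronecker products\<close>

text \<open>Entries of Kronecker products are indexed by pairs encoded as \<open>c = i * q + j\<close>. This is what turns
  a sum over such indices into a double sum.\<close>

lemma sum_div_mod:
  fixes h :: "nat \<Rightarrow> nat \<Rightarrow> 'a::comm_monoid_add"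
  shows "(\<Sum>c<p * q. h (c div q) (c mod q)) = (\<Sum>i<p. \<Sum>j<q. h i j)"
proof (cases "q = 0")
  case False
  have "(\<Sum>i<p. \<Sum>j<q. h i j) = (\<Sum>(i, j)\<in>{..<p} \<times> {..<q}. h i j)"
    by (simp add: sum.cartesian_product)
  also have "\<dots> = (\<Sum>c<p * q. h (c div q) (c mod q))"
  proof (rule sum.reindex_bij_witness[where j = "\<lambda>(i, j). i * q + j" and i = "\<lambda>c. (c div q, c mod q)"])
    fix a assume a: "a \<in> {..<p} \<times> {..<q}"
    then obtain i j where ij: "a = (i, j)" "i < p" "j < q" by auto
    have "i * q + j < Suc i * q" using ij by simp
    also have "\<dots> \<le> p * q" using ij by (intro mult_le_mono1) simp
    finally show "(case a of (i, j) \<Rightarrow> i * q + j) \<in> {..<p * q}" using ij by simp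
  qed (use False in \<open>auto simp: less_mult_imp_div_less\<close>)
  finally show ?thesis by simp
qed simp

lemma dim_kron_vec [simp]: "dim_vec (kron_vec u v) = dim_vec u * dim_vec v"
  by (simp add: kron_vec_def)

lemma dim_kron_mat [simp]:
  "dim_row (kron_mat A B) = dim_row A * dim_row B"
  "dim_col (kron_mat A B) = dim_col A * dim_col B"
  by (simp_all add: kron_mat_def)

lemma dim_kron_pow_vec [simp]: "dim_vec (kron_pow_vec x i) = dim_vec x ^ i"
  by (induction i) simp_all

lemma kron_vec_index:
  "k < dim_vec u * dim_vec v \<Longrightarrow> kron_vec u v $ k = u $ (k div dim_vec v) * v $ (k mod dim_vec v)"
  by (simp add: kron_vec_def)

lemma kron_mat_index:
  "r < dim_row A * dim_row B \<Longrightarrow> c < dim_col A * dim_col B \<Longrightarrow> kron_mat A B $$ (r, c)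
     = A $$ (r div dim_row B, c div dim_col B) * B $$ (r mod dim_row B, c mod dim_col B)"
  by (simp add: kron_mat_def)

lemma div_mod_less_mult:
  fixes r p q :: nat
  assumes "r < p * q"
  shows "r div q < p" "r mod q < q"
proof -
  from assms have "q > 0" by (cases q) auto
  then show "r div q < p" "r mod q < q" using assms by (auto simp: less_mult_imp_div_less)
qed

text \<open>The mixed-product rule: the double sum over the column index factors.\<close>

lemma kron_mat_mult_kron_vec:
  assumes "dim_vec u = dim_col A" "dim_vec v = dim_col B"
  shows "kron_mat A B *\<^sub>v kron_vec u v = kron_vec (A *\<^sub>v u) (B *\<^sub>v v)"
proof (rule eq_vecI)
  fix r assume "r < dim_vec (kron_vec (A *\<^sub>v u) (B *\<^sub>v v))"
  then have r: "r < dim_row A * dim_row B" by simp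
  note rs = div_mod_less_mult[OF r]
  have "(kron_mat A B *\<^sub>v kron_vec u v) $ r
      = (\<Sum>c<dim_col A * dim_col B. kron_mat A B $$ (r, c) * kron_vec u v $ c)"
    using r assms by (simp add: scalar_prod_def atLeast0LessThan row_def)
  also have "\<dots> = (\<Sum>c<dim_col A * dim_col B.
       (\<lambda>i j. (A $$ (r div dim_row B, i) * u $ i) * (B $$ (r mod dim_row B, j) * v $ j))
          (c div dim_col B) (c mod dim_col B))"
    using r assms by (intro sum.cong) (simp_all add: kron_mat_index kron_vec_index algebra_simps)
  also have "\<dots> = (\<Sum>i<dim_col A. A $$ (r div dim_row B, i) * u $ i)
                * (\<Sum>j<dim_col B. B $$ (r mod dim_row B, j) * v $ j)"
    unfolding sum_product by (rule sum_div_mod)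
  also have "\<dots> = kron_vec (A *\<^sub>v u) (B *\<^sub>v v) $ r"
    using r rs assms by (simp add: kron_vec_index scalar_prod_def atLeast0LessThan row_def)
  finally show "(kron_mat A B *\<^sub>v kron_vec u v) $ r = kron_vec (A *\<^sub>v u) (B *\<^sub>v v) $ r" .
qed simp

lemma kron_vec_assoc: "kron_vec (kron_vec u v) w = kron_vec u (kron_vec v w)"
proof (rule eq_vecI)
  fix k assume "k < dim_vec (kron_vec u (kron_vec v w))"
  then have k: "k < (dim_vec u * dim_vec v) * dim_vec w" "k < dim_vec u * (dim_vec v * dim_vec w)"
    by (simp_all add: mult.assoc)
  note ks = div_mod_less_mult[OF k(1)] div_mod_less_mult[OF k(2)]
  have k1: "k div dim_vec w div dim_vec v = k div (dim_vec v * dim_vec w)"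
    by (simp add: div_mult2_eq mult.commute[of "dim_vec v"])
  have k2: "k mod (dim_vec v * dim_vec w) = dim_vec w * (k div dim_vec w mod dim_vec v) + k mod dim_vec w"
    by (simp add: mod_mult2_eq mult.commute[of "dim_vec v"])
  have k3: "k mod (dim_vec v * dim_vec w) div dim_vec w = k div dim_vec w mod dim_vec v"
    "k mod (dim_vec v * dim_vec w) mod dim_vec w = k mod dim_vec w"
    unfolding k2 using ks(2) by (cases "dim_vec w = 0"; simp)+
  show "kron_vec (kron_vec u v) w $ k = kron_vec u (kron_vec v w) $ k"
    using k ks by (simp add: kron_vec_index k1 k3)
qed (simp add: mult.assoc)

lemma kron_vec_unit_left: "kron_vec (vec 1 (\<lambda>_. 1)) v = v"
  by (rule eq_vecI) (simp_all add: kron_vec_index)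

lemma kron_pow_vec_one: "kron_pow_vec x 1 = x"
  by (rule eq_vecI) (simp_all add: kron_vec_index)

lemma kron_pow_vec_add:
  "kron_pow_vec x (i + j) = kron_vec (kron_pow_vec x i) (kron_pow_vec x j)"
  by (induction i) (simp_all add: kron_vec_unit_left kron_vec_assoc del: One_nat_def)

lemma kron_mat_one: "kron_mat (1\<^sub>m p) (1\<^sub>m q) = 1\<^sub>m (p * q)"
proof (rule eq_matI)
  fix r c assume "r < dim_row (1\<^sub>m (p * q) :: real mat)" "c < dim_col (1\<^sub>m (p * q) :: real mat)"
  then have rc: "r < p * q" "c < p * q" by simp_all
  note s = div_mod_less_mult[OF rc(1)] div_mod_less_mult[OF rc(2)]
  have "r = c \<longleftrightarrow> r div q = c div q \<and> r mod q = c mod q"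
    by (metis mod_div_mult_eq)
  then show "kron_mat (1\<^sub>m p) (1\<^sub>m q) $$ (r, c) = 1\<^sub>m (p * q) $$ (r, c)"
    using rc s by (auto simp: kron_mat_index)
qed simp_all

lemma kron_pow_mat_one: "kron_pow_mat (1\<^sub>m n) i = 1\<^sub>m (n ^ i)"
  by (induction i) (simp_all add: kron_mat_one)

section \<open>Norm bounds\<close>

text \<open>The sup norm of a matrix is the largest of these. Working with a fixed row avoids the maximum,
  and rows behave multiplicatively under Kronecker products.\<close>

definition abs_row_sum :: "real mat \<Rightarrow> nat \<Rightarrow> real" where
  "abs_row_sum A r = (\<Sum>c<dim_col A. \<bar>A $$ (r, c)\<bar>)"

lemma abs_row_sum_nonneg: "0 \<le> abs_row_sum A r"
  by (simp add: abs_row_sum_def sum_nonneg)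

lemma abs_row_sum_kron:
  assumes r: "r < dim_row A * dim_row B"
  shows "abs_row_sum (kron_mat A B) r
       = abs_row_sum A (r div dim_row B) * abs_row_sum B (r mod dim_row B)"
proof -
  have "abs_row_sum (kron_mat A B) r = (\<Sum>c<dim_col A * dim_col B.
     (\<lambda>i j. \<bar>A $$ (r div dim_row B, i)\<bar> * \<bar>B $$ (r mod dim_row B, j)\<bar>) (c div dim_col B) (c mod dim_col B))"
    unfolding abs_row_sum_def using r
    by (intro sum.cong) (simp_all add: kron_mat_index abs_mult)
  also have "\<dots> = abs_row_sum A (r div dim_row B) * abs_row_sum B (r mod dim_row B)"
    unfolding sum_product abs_row_sum_def by (rule sum_div_mod)
  finally show ?thesis .
qed

lemma abs_row_sum_one: "r < m \<Longrightarrow> abs_row_sum (1\<^sub>m m) r = 1"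
  by (simp add: abs_row_sum_def if_distrib[of abs] cong: if_cong)

lemma abs_row_sum_le_sup_norm: "r < dim_row A \<Longrightarrow> abs_row_sum A r \<le> sup_norm_mat A"
  unfolding sup_norm_mat_def abs_row_sum_def by (rule Max_ge) auto

lemma abs_index_le_sup_norm: "k < dim_vec v \<Longrightarrow> \<bar>v $ k\<bar> \<le> sup_norm_vec v"
  unfolding sup_norm_vec_def by (rule Max_ge) auto

lemma sup_norm_vec_le:
  assumes "0 < dim_vec v" "\<And>k. k < dim_vec v \<Longrightarrow> \<bar>v $ k\<bar> \<le> M"
  shows "sup_norm_vec v \<le> M"
  using assms unfolding sup_norm_vec_def by (subst Max_le_iff) auto

lemma sup_norm_vec_nonneg: "0 < dim_vec v \<Longrightarrow> 0 \<le> sup_norm_vec v"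
  using abs_index_le_sup_norm[of 0 v] by (smt (verit) abs_ge_zero)

lemma sup_norm_mat_nonneg: "0 < dim_row A \<Longrightarrow> 0 \<le> sup_norm_mat A"
  using abs_row_sum_le_sup_norm[of 0 A] abs_row_sum_nonneg[of A 0] by linarith

lemma abs_mult_mat_vec_le:
  assumes r: "r < dim_row A" and d: "dim_vec v = dim_col A" and S: "abs_row_sum A r \<le> S"
    and M: "\<And>c. c < dim_vec v \<Longrightarrow> \<bar>v $ c\<bar> \<le> M" and "0 \<le> M"
  shows "\<bar>(A *\<^sub>v v) $ r\<bar> \<le> S * M"
proof -
  have "\<bar>(A *\<^sub>v v) $ r\<bar> = \<bar>\<Sum>c<dim_col A. A $$ (r, c) * v $ c\<bar>"
    using r d by (simp add: scalar_prod_def atLeast0LessThan row_def)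
  also have "\<dots> \<le> (\<Sum>c<dim_col A. \<bar>A $$ (r, c) * v $ c\<bar>)" by (rule sum_abs)
  also have "\<dots> \<le> (\<Sum>c<dim_col A. \<bar>A $$ (r, c)\<bar> * M)"
    using M d by (intro sum_mono) (auto simp: abs_mult intro!: mult_left_mono)
  also have "\<dots> = abs_row_sum A r * M" by (simp add: abs_row_sum_def sum_distrib_right)
  also have "\<dots> \<le> S * M" using S \<open>0 \<le> M\<close> by (rule mult_right_mono)
  finally show ?thesis .
qed

text \<open>Each entry of the \<open>i\<close>-th power is a product of \<open>i\<close> entries of \<open>x\<close>.\<close>

lemma abs_kron_pow_vec_le:
  assumes "\<And>k. k < dim_vec x \<Longrightarrow> \<bar>x $ k\<bar> \<le> M" and "k < dim_vec x ^ i"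
  shows "\<bar>kron_pow_vec x i $ k\<bar> \<le> M ^ i"
  using assms(2)
proof (induction i arbitrary: k)
  case (Suc i)
  then have k: "k < dim_vec x * dim_vec x ^ i" by simp
  have "\<bar>x $ (k div dim_vec x ^ i)\<bar> * \<bar>kron_pow_vec x i $ (k mod dim_vec x ^ i)\<bar> \<le> M * M ^ i"
    using div_mod_less_mult[OF k] Suc.IH assms(1)
    by (intro mult_mono) (auto intro: order_trans[OF abs_ge_zero])
  with k show ?case by (simp add: kron_vec_index abs_mult)
qed simp

section \<open>Transfer matrices and the derivative of Kronecker powers\<close>

definition transfer_summand :: "nat \<Rightarrow> real mat \<Rightarrow> nat \<Rightarrow> nat \<Rightarrow> real mat" where
  "transfer_summand n F i \<nu> = kron_mat (kron_mat (1\<^sub>m (n ^ (\<nu> - 1))) F) (1\<^sub>m (n ^ (i - \<nu>)))"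

lemma power_transfer_split:
  fixes n :: nat
  assumes "\<nu> \<in> {1..i}" "1 \<le> j"
  shows "n ^ (\<nu> - 1) * n ^ j * n ^ (i - \<nu>) = n ^ (i + j - 1)"
proof -
  have "\<nu> - 1 + j + (i - \<nu>) = i + j - 1" using assms by auto
  then show ?thesis by (metis power_add)
qed

lemma dim_transfer_summand:
  assumes "\<nu> \<in> {1..i}" "1 \<le> j" "F \<in> carrier_mat n (n ^ j)"
  shows "dim_row (transfer_summand n F i \<nu>) = n ^ i"
    "dim_col (transfer_summand n F i \<nu>) = n ^ (i + j - 1)"
  using power_transfer_split[OF assms(1), of 1 n] power_transfer_split[OF assms(1,2), of n] assms(3)
  by (simp_all add: transfer_summand_def)

lemma dim_transfer_mat [simp]:
  "dim_row (transfer_mat n F j i) = n ^ i" "dim_col (transfer_mat n F j i) = n ^ (i + j - 1)"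
  by (simp_all add: transfer_mat_def)

lemma transfer_mat_index:
  "r < n ^ i \<Longrightarrow> c < n ^ (i + j - 1) \<Longrightarrow>
     transfer_mat n F j i $$ (r, c) = (\<Sum>\<nu>=1..i. transfer_summand n F i \<nu> $$ (r, c))"
  by (simp add: transfer_mat_def transfer_summand_def kron_pow_mat_one)

text \<open>Rows of identity matrices have absolute sum one, so only the row sum of the factor \<open>F\<close> remains.\<close>

lemma abs_row_sum_transfer_summand:
  assumes "\<nu> \<in> {1..i}" "1 \<le> j" and F: "F \<in> carrier_mat n (n ^ j)" and r: "r < n ^ i"
  shows "abs_row_sum (transfer_summand n F i \<nu>) r \<le> sup_norm_mat F"
proof -
  have r': "r < (n ^ (\<nu> - 1) * n) * n ^ (i - \<nu>)"
    using r power_transfer_split[OF assms(1), of 1 n] by simp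
  note s = div_mod_less_mult[OF r']
  note s' = div_mod_less_mult[OF s(1)]
  have "abs_row_sum (transfer_summand n F i \<nu>) r = abs_row_sum F (r div n ^ (i - \<nu>) mod n)"
    unfolding transfer_summand_def using F r' s s'
    by (simp add: abs_row_sum_kron abs_row_sum_one)
  also have "\<dots> \<le> sup_norm_mat F" using F s' by (intro abs_row_sum_le_sup_norm) simp
  finally show ?thesis .
qed

lemma abs_row_sum_transfer_mat:
  assumes j: "1 \<le> j" and F: "F \<in> carrier_mat n (n ^ j)" and r: "r < n ^ i"
  shows "abs_row_sum (transfer_mat n F j i) r \<le> real i * sup_norm_mat F"
proof -
  have "abs_row_sum (transfer_mat n F j i) r
      \<le> (\<Sum>c<n ^ (i + j - 1). \<Sum>\<nu>=1..i. \<bar>transfer_summand n F i \<nu> $$ (r, c)\<bar>)"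
    unfolding abs_row_sum_def using r by (auto simp: transfer_mat_index intro!: sum_mono sum_abs)
  also have "\<dots> = (\<Sum>\<nu>=1..i. \<Sum>c<n ^ (i + j - 1). \<bar>transfer_summand n F i \<nu> $$ (r, c)\<bar>)"
    by (rule sum.swap)
  also have "\<dots> = (\<Sum>\<nu>=1..i. abs_row_sum (transfer_summand n F i \<nu>) r)"
    by (intro sum.cong) (simp_all add: abs_row_sum_def dim_transfer_summand[OF _ j F])
  also have "\<dots> \<le> (\<Sum>\<nu>=1..i. sup_norm_mat F)"
    by (intro sum_mono abs_row_sum_transfer_summand[OF _ j F r])
  finally show ?thesis by simp
qed

text \<open>The power \<open>i + j - 1\<close> splits as \<open>(\<nu> - 1) + j + (i - \<nu>)\<close>. By the mixed-product rule the
  \<open>\<nu>\<close>-th summand acts on the middle block only, merging \<open>j\<close> factors into the single factor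
  \<open>F x\<^sup>[\<^sup>j\<^sup>]\<close>.\<close>

lemma transfer_mat_mult_kron_pow:
  assumes x: "dim_vec x = n" and j: "1 \<le> j" and F: "F \<in> carrier_mat n (n ^ j)" and r: "r < n ^ i"
  shows "(transfer_mat n F j i *\<^sub>v kron_pow_vec x (i + j - 1)) $ r
     = (\<Sum>\<nu>=1..i. kron_vec (kron_vec (kron_pow_vec x (\<nu> - 1)) (F *\<^sub>v kron_pow_vec x j))
                         (kron_pow_vec x (i - \<nu>)) $ r)"
proof -
  let ?X = "kron_pow_vec x (i + j - 1)"
  have *: "(transfer_summand n F i \<nu> *\<^sub>v ?X) $ r
     = kron_vec (kron_vec (kron_pow_vec x (\<nu> - 1)) (F *\<^sub>v kron_pow_vec x j)) (kron_pow_vec x (i - \<nu>)) $ r"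
    if \<nu>: "\<nu> \<in> {1..i}" for \<nu>
  proof -
    have "i + j - 1 = (\<nu> - 1 + j) + (i - \<nu>)" using \<nu> j by auto
    then have X: "?X = kron_vec (kron_vec (kron_pow_vec x (\<nu> - 1)) (kron_pow_vec x j)) (kron_pow_vec x (i - \<nu>))"
      by (simp only: kron_pow_vec_add)
    have one: "1\<^sub>m (n ^ k) *\<^sub>v kron_pow_vec x k = kron_pow_vec x k" for k
      using x by (intro one_mult_mat_vec carrier_vecI) simp
    show ?thesis unfolding X transfer_summand_def
      using x F by (simp add: kron_mat_mult_kron_vec one)
  qed
  have "(transfer_mat n F j i *\<^sub>v ?X) $ r
      = (\<Sum>c<n ^ (i + j - 1). \<Sum>\<nu>=1..i. transfer_summand n F i \<nu> $$ (r, c) * ?X $ c)"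
    using r x by (simp add: scalar_prod_def atLeast0LessThan row_def transfer_mat_index sum_distrib_right)
  also have "\<dots> = (\<Sum>\<nu>=1..i. \<Sum>c<n ^ (i + j - 1). transfer_summand n F i \<nu> $$ (r, c) * ?X $ c)"
    by (rule sum.swap)
  also have "\<dots> = (\<Sum>\<nu>=1..i. (transfer_summand n F i \<nu> *\<^sub>v ?X) $ r)"
    using r x by (intro sum.cong)
      (simp_all add: scalar_prod_def atLeast0LessThan row_def dim_transfer_summand[OF _ j F])
  also have "\<dots> = (\<Sum>\<nu>=1..i. kron_vec (kron_vec (kron_pow_vec x (\<nu> - 1)) (F *\<^sub>v kron_pow_vec x j))
                         (kron_pow_vec x (i - \<nu>)) $ r)"
    by (intro sum.cong refl *)
  finally show ?thesis .
qed

text \<open>The product rule: each of the \<open>i\<close> factors is differentiated in turn. The derivative \<open>d\<close> is kept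
  abstract, because it will be a sum of a linear and a quadratic part. The dimension of \<open>x s\<close> is
  known for \<open>s \<in> I\<close> only, so the recursion is used within \<open>I\<close>.\<close>

lemma kron_pow_vec_has_derivative:
  assumes x: "\<And>s. s \<in> I \<Longrightarrow> dim_vec (x s) = n" and t: "t \<in> I" and d: "dim_vec d = n"
    and x': "\<And>k. k < n \<Longrightarrow> ((\<lambda>s. x s $ k) has_real_derivative d $ k) (at t within I)"
    and "r < n ^ i"
  shows "((\<lambda>s. kron_pow_vec (x s) i $ r) has_real_derivative
     (\<Sum>\<nu>=1..i. kron_vec (kron_vec (kron_pow_vec (x t) (\<nu> - 1)) d) (kron_pow_vec (x t) (i - \<nu>)) $ r))
     (at t within I)"
  using \<open>r < n ^ i\<close>
proof (induction i arbitrary: r)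
  case (Suc i)
  let ?D = "\<lambda>i \<nu>. kron_vec (kron_vec (kron_pow_vec (x t) (\<nu> - 1)) d) (kron_pow_vec (x t) (i - \<nu>))"
  let ?q = "r div n ^ i" and ?m = "r mod n ^ i"
  have r: "r < n * n ^ i" using Suc.prems by simp
  note s = div_mod_less_mult[OF r]
  \<comment> \<open>Either the leading factor is differentiated, or it is kept and the derivative falls on the
    remaining \<open>i\<close> factors.\<close>
  have head: "?D (Suc i) 1 $ r = d $ ?q * kron_pow_vec (x t) i $ ?m"
    using r d x[OF t] by (simp add: kron_vec_unit_left kron_vec_index del: One_nat_def)
  have tail: "?D (Suc i) (Suc \<nu>) $ r = x t $ ?q * ?D i \<nu> $ ?m" if "\<nu> \<in> {1..i}" for \<nu>
  proof -
    obtain \<mu> where \<mu>: "\<nu> = Suc \<mu>" using \<open>\<nu> \<in> {1..i}\<close> by (cases \<nu>) auto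
    have dim: "n ^ \<mu> * (n * n ^ (i - Suc \<mu>)) = n ^ i"
      using that \<mu> power_transfer_split[of \<nu> i 1 n] by (simp add: mult.assoc)
    show ?thesis
      using r d x[OF t] dim s by (simp add: \<mu> kron_vec_assoc kron_vec_index[of r])
  qed
  have "(\<Sum>\<nu>=1..Suc i. ?D (Suc i) \<nu> $ r) = ?D (Suc i) 1 $ r + (\<Sum>\<nu>=1..i. ?D (Suc i) (Suc \<nu>) $ r)"
    by (subst sum.atLeast_Suc_atMost) (simp_all only: sum.shift_bounds_cl_Suc_ivl One_nat_def le_simps)
  also have "\<dots> = d $ ?q * kron_pow_vec (x t) i $ ?m + (\<Sum>\<nu>=1..i. x t $ ?q * ?D i \<nu> $ ?m)"
    using tail by (simp only: head cong: sum.cong)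
  finally have eq: "(\<Sum>\<nu>=1..Suc i. ?D (Suc i) \<nu> $ r)
      = d $ ?q * kron_pow_vec (x t) i $ ?m + (\<Sum>\<nu>=1..i. ?D i \<nu> $ ?m) * x t $ ?q"
    by (simp add: sum_distrib_left mult.commute)
  have "((\<lambda>s. x s $ ?q * kron_pow_vec (x s) i $ ?m) has_real_derivative
      (\<Sum>\<nu>=1..Suc i. ?D (Suc i) \<nu> $ r)) (at t within I)"
    unfolding eq by (rule DERIV_mult[OF x'[OF s(1)] Suc.IH[OF s(2)]])
  then show ?case
    by (rule has_field_derivative_transform_within[where d = 1])
       (use r x t in \<open>simp_all add: kron_vec_index\<close>)
qed simp

text \<open>The infinite Carleman system. Inserting \<open>x' = F\<^sub>1 x + F\<^sub>2 x\<^sup>[\<^sup>2\<^sup>]\<close> into the product rule and using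
  that the Kronecker product is additive in the middle factor yields the two transfer matrices.\<close>

lemma kron_pow_solution_has_derivative:
  assumes F1: "F1 \<in> carrier_mat n n" and F2: "F2 \<in> carrier_mat n (n ^ 2)"
    and x: "quadratic_ode_solution n F1 F2 x0 I x" and t: "t \<in> I" and r: "r < n ^ i"
  shows "((\<lambda>s. kron_pow_vec (x s) i $ r) has_real_derivative
     (transfer_mat n F1 1 i *\<^sub>v kron_pow_vec (x t) i
      + transfer_mat n F2 2 i *\<^sub>v kron_pow_vec (x t) (i + 1)) $ r) (at t within I)"
proof -
  have dx: "\<And>s. s \<in> I \<Longrightarrow> dim_vec (x s) = n"
    using x by (auto simp: quadratic_ode_solution_def)
  let ?d1 = "F1 *\<^sub>v x t" and ?d2 = "F2 *\<^sub>v kron_pow_vec (x t) 2"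
  have x': "((\<lambda>s. x s $ k) has_real_derivative (?d1 + ?d2) $ k) (at t within I)" if "k < n" for k
    using x t that F2 unfolding quadratic_ode_solution_def has_vec_deriv_def
    by (simp add: carrier_matD(1))
  have split: "kron_vec (kron_vec p (?d1 + ?d2)) q $ r
      = kron_vec (kron_vec p ?d1) q $ r + kron_vec (kron_vec p ?d2) q $ r"
    if "dim_vec p * n * dim_vec q = n ^ i" for p q
  proof -
    have r': "r < dim_vec p * n * dim_vec q" using r that by simp
    note s = div_mod_less_mult[OF r']
    note s' = div_mod_less_mult[OF s(1)]
    show ?thesis using r' s s' F1 F2 by (simp add: kron_vec_index algebra_simps)
  qed
  have e1: "(transfer_mat n F1 1 i *\<^sub>v kron_pow_vec (x t) i) $ r
     = (\<Sum>\<nu>=1..i. kron_vec (kron_vec (kron_pow_vec (x t) (\<nu> - 1)) ?d1) (kron_pow_vec (x t) (i - \<nu>)) $ r)"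
    using transfer_mat_mult_kron_pow[OF dx[OF t], of 1 F1 r i] F1 r
    unfolding kron_pow_vec_one by simp
  have e2: "(transfer_mat n F2 2 i *\<^sub>v kron_pow_vec (x t) (i + 1)) $ r
     = (\<Sum>\<nu>=1..i. kron_vec (kron_vec (kron_pow_vec (x t) (\<nu> - 1)) ?d2) (kron_pow_vec (x t) (i - \<nu>)) $ r)"
    using transfer_mat_mult_kron_pow[OF dx[OF t], of 2 F2 r i] F2 r by simp
  have "(\<Sum>\<nu>=1..i. kron_vec (kron_vec (kron_pow_vec (x t) (\<nu> - 1)) (?d1 + ?d2)) (kron_pow_vec (x t) (i - \<nu>)) $ r)
      = (transfer_mat n F1 1 i *\<^sub>v kron_pow_vec (x t) i
      + transfer_mat n F2 2 i *\<^sub>v kron_pow_vec (x t) (i + 1)) $ r"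
    (is "?S = _")
  proof -
    have "?S = (\<Sum>\<nu>=1..i. kron_vec (kron_vec (kron_pow_vec (x t) (\<nu> - 1)) ?d1) (kron_pow_vec (x t) (i - \<nu>)) $ r
              + kron_vec (kron_vec (kron_pow_vec (x t) (\<nu> - 1)) ?d2) (kron_pow_vec (x t) (i - \<nu>)) $ r)"
      using power_transfer_split[of _ i 1 n] dx[OF t] by (intro sum.cong refl split) simp
    also have "\<dots> = (transfer_mat n F1 1 i *\<^sub>v kron_pow_vec (x t) i) $ r
      + (transfer_mat n F2 2 i *\<^sub>v kron_pow_vec (x t) (i + 1)) $ r"
      by (simp only: sum.distrib e1 e2)
    finally show ?thesis using r by (subst index_add_vec) simp_all
  qed
  moreover have "dim_vec (?d1 + ?d2) = n" using F2 by simp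
  ultimately show ?thesis using kron_pow_vec_has_derivative[OF dx t _ x' r] by metis
qed

section \<open>A comparison principle\<close>

text \<open>A finite family of functions stays below \<open>v\<close> in absolute value if it starts there and if, whenever
  all its members lie below \<open>v + h\<close>, their derivatives exceed \<open>v'\<close> by at most \<open>L h\<close>. For a scalar
  right-hand side \<open>\<phi>\<close> with \<open>v' = \<phi>(t, v)\<close> the growth condition follows from monotonicity and a
  Lipschitz bound of \<open>\<phi>\<close> just above \<open>v\<close>; the restriction \<open>h \<le> 1\<close> lets a local Lipschitz bound suffice,
  as is needed for a quadratic \<open>\<phi>\<close>.

  The function \<open>V = v + d e\<^sup>K\<^sup>t\<close> with \<open>K > L\<close> grows strictly faster than the family can at a point
  where the family first reaches \<open>V\<close>, so that it is never reached; then \<open>d\<close> tends to zero.\<close>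

lemma comparison_principle:
  fixes z z' :: "nat \<Rightarrow> real \<Rightarrow> real" and v v' :: "real \<Rightarrow> real"
  assumes z: "\<And>k t. k < m \<Longrightarrow> t \<in> {0..T} \<Longrightarrow> (z k has_real_derivative z' k t) (at t within {0..T})"
    and v: "\<And>t. t \<in> {0..T} \<Longrightarrow> (v has_real_derivative v' t) (at t within {0..T})"
    and init: "\<And>k. k < m \<Longrightarrow> \<bar>z k 0\<bar> \<le> v 0"
    and L: "0 \<le> L"
    and growth: "\<And>k t h. k < m \<Longrightarrow> t \<in> {0..T} \<Longrightarrow> 0 < h \<Longrightarrow> h \<le> 1 \<Longrightarrow>
        (\<forall>j<m. \<bar>z j t\<bar> \<le> v t + h) \<Longrightarrow> \<bar>z' k t\<bar> \<le> v' t + L * h"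
    and k: "k < m" and t: "t \<in> {0..T}"
  shows "\<bar>z k t\<bar> \<le> v t"
proof -
  define K where "K = L + 1"
  have K: "0 < K" using L by (simp add: K_def)
  have strict: "\<bar>z k s\<bar> < v s + d * exp (K * s)"
    if d: "0 < d" "d * exp (K * T) \<le> 1" and k: "k < m" and s: "s \<in> {0..T}" for d k s
  proof (rule ccontr)
    define V where "V = (\<lambda>s. v s + d * exp (K * s))"
    assume "\<not> \<bar>z k s\<bar> < v s + d * exp (K * s)"
    then have bad: "V s \<le> \<bar>z k s\<bar>" by (simp add: V_def)
    have V': "(V has_real_derivative (v' s + K * (d * exp (K * s)))) (at s within {0..T})"
      if "s \<in> {0..T}" for s
      unfolding V_def using v[OF that] by (auto intro!: derivative_eq_intros)
    have contV: "continuous_on {0..T} V"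
      using V' by (meson DERIV_continuous continuous_on_eq_continuous_within)
    have contz: "continuous_on {0..T} (z j)" if "j < m" for j
      using z[OF that] by (meson DERIV_continuous continuous_on_eq_continuous_within)
    \<comment> \<open>The first time \<open>t0\<close> at which some member reaches \<open>V\<close> exists by compactness.\<close>
    define S where "S = (\<Union>j<m. {r \<in> {0..T}. V r \<le> \<bar>z j r\<bar>})"
    have "closed S" unfolding S_def
      using contV contz by (intro closed_UN continuous_on_closed_Collect_le ballI continuous_on_rabs) auto
    moreover have "S \<subseteq> {0..T}" by (auto simp: S_def)
    ultimately have "compact S"
      by (metis compact_Icc compact_Int_closed inf.absorb_iff2)
    moreover have "S \<noteq> {}" using bad k s by (auto simp: S_def)
    ultimately obtain t0 where t0: "t0 \<in> S" and least: "\<And>r. r \<in> S \<Longrightarrow> t0 \<le> r"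
      by (metis compact_attains_inf)
    from t0 obtain j where j: "j < m" "t0 \<in> {0..T}" "V t0 \<le> \<bar>z j t0\<bar>" by (auto simp: S_def)
    have before: "\<bar>z i r\<bar> < V r" if "i < m" "0 \<le> r" "r < t0" for i r
      using least[of r] that j(2) by (force simp: S_def)
    have "t0 \<noteq> 0"
      using init[OF j(1)] j(3) d by (auto simp: V_def)
    then have t0pos: "0 < t0" using j(2) by simp
    \<comment> \<open>At \<open>t0\<close> all members are still bounded by \<open>V\<close>, so the growth condition applies with
      \<open>h = d e\<^sup>K\<^sup>t\<^sup>0\<close>.\<close>
    have le: "\<bar>z i t0\<bar> \<le> V t0" if i: "i < m" for i
    proof -
      have "continuous_on (closure {0..<t0}) (\<lambda>r. V r - \<bar>z i r\<bar>)"
        using t0pos j(2) by (auto intro!: continuous_intros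
            continuous_on_subset[OF contV] continuous_on_subset[OF contz[OF i]])
      then have "0 \<le> V t0 - \<bar>z i t0\<bar>"
        by (rule continuous_ge_on_closure) (use t0pos before[OF i] in \<open>auto intro: less_imp_le\<close>)
      then show ?thesis by simp
    qed
    let ?h = "d * exp (K * t0)"
    have "?h \<le> d * exp (K * T)" using d K j(2) by simp
    then have h: "0 < ?h" "?h \<le> 1" using d by (simp, linarith)
    have "\<bar>z' j t0\<bar> \<le> v' t0 + L * ?h"
      using growth[OF j(1,2) h] le by (simp add: V_def)
    also have "\<dots> < v' t0 + K * ?h" using h unfolding K_def by (simp only: distrib_right mult_1_left)
    finally have slope: "\<bar>z' j t0\<bar> < v' t0 + K * ?h" .
    \<comment> \<open>With the sign \<open>\<sigma>\<close> of the member that touches, \<open>V - \<sigma> z\<close> is increasing at \<open>t0\<close> and not positive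
      there, hence negative shortly before \<open>t0\<close>.\<close>
    define \<sigma> :: real where "\<sigma> = (if z j t0 \<ge> 0 then 1 else -1)"
    have "((\<lambda>r. V r - \<sigma> * z j r) has_real_derivative (v' t0 + K * ?h - \<sigma> * z' j t0)) (at t0 within {0..T})"
      using V'[OF j(2)] z[OF j(1,2)] by (auto intro!: derivative_eq_intros)
    moreover have "0 < v' t0 + K * ?h - \<sigma> * z' j t0"
      using slope by (auto simp: \<sigma>_def)
    ultimately obtain e where e: "0 < e"
      "\<And>h. 0 < h \<Longrightarrow> t0 - h \<in> {0..T} \<Longrightarrow> h < e \<Longrightarrow> V (t0 - h) - \<sigma> * z j (t0 - h) < V t0 - \<sigma> * z j t0"
      using has_real_derivative_pos_inc_left by blast
    define g where "g = min (e / 2) t0"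
    have g: "0 < g" "g < e" "t0 - g \<in> {0..T}" "g \<le> t0"
      using e(1) t0pos j(2) by (auto simp: g_def)
    have "V (t0 - g) - \<sigma> * z j (t0 - g) < V t0 - \<sigma> * z j t0" using e(2) g by blast
    also have "V t0 - \<sigma> * z j t0 \<le> 0" using j(3) by (auto simp: \<sigma>_def)
    finally have "V (t0 - g) < \<bar>z j (t0 - g)\<bar>" by (auto simp: \<sigma>_def split: if_splits)
    with before[OF j(1), of "t0 - g"] g show False by simp
  qed
  show ?thesis
  proof (rule field_le_epsilon)
    fix e :: real assume e: "0 < e"
    define d where "d = min 1 e / exp (K * T)"
    have "0 < d" "d * exp (K * T) \<le> 1" using e by (auto simp: d_def)
    then have "\<bar>z k t\<bar> < v t + d * exp (K * t)" using strict k t by blast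
    also have "d * exp (K * t) \<le> d * exp (K * T)" using \<open>0 < d\<close> K t by simp
    also have "d * exp (K * T) \<le> e" by (simp add: d_def)
    finally show "\<bar>z k t\<bar> \<le> v t + e" by simp
  qed
qed

section \<open>The scalar equation and its Carleman truncation\<close>

text \<open>The equation \<open>u' = a u + b u\<^sup>2\<close>, \<open>u(0) = u0\<close>, on an interval \<open>[0, T]\<close> before its blow-up.\<close>

locale scalar_majorant =
  fixes a b u0 T :: real
  assumes a: "0 < a" and b: "0 \<le> b" and u0: "0 \<le> u0"
    and before_blowup: "u0 * b / a * (exp (a * T) - 1) < 1"
begin

text \<open>The ratio of the geometric series for the solution; blow-up occurs when it reaches one.\<close>

definition w :: "real \<Rightarrow> real" where
  "w t = u0 * b / a * (exp (a * t) - 1)"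

definition u :: "real \<Rightarrow> real" where
  "u t = u0 * exp (a * t) / (1 - w t)"

text \<open>The \<open>i\<close>-th unknown of the Carleman system of the scalar equation truncated at order \<open>N\<close>: the
  binomial series of \<open>u\<^sup>i\<close> in powers of \<open>w\<close>, cut off after the exponent \<open>N - i\<close>. The upper limit is
  written \<open>Suc N - i\<close> so that level \<open>N + 1\<close> is the empty sum.\<close>

definition truncated :: "nat \<Rightarrow> nat \<Rightarrow> real \<Rightarrow> real" where
  "truncated N i t = u0 ^ i * exp (a * t) ^ i * (\<Sum>k<Suc N - i. real ((i + k - 1) choose k) * w t ^ k)"

lemma w_bounds:
  assumes "t \<in> {0..T}"
  shows "0 \<le> w t" "w t < 1"
proof -
  have nn: "0 \<le> u0 * b / a" using a b u0 by simp
  show "0 \<le> w t" unfolding w_def using nn a assms by (intro mult_nonneg_nonneg) auto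
  have "w t \<le> w T" unfolding w_def using nn a assms by (intro mult_left_mono) auto
  then show "w t < 1" using before_blowup by (simp add: w_def)
qed

lemma w_deriv: "(w has_real_derivative u0 * b * exp (a * t)) (at t within X)"
  unfolding w_def using a by (auto intro!: derivative_eq_intros)

lemma u_nonneg: "t \<in> {0..T} \<Longrightarrow> 0 \<le> u t"
  using w_bounds(2)[of t] u0 by (simp add: u_def)

lemma u_le:
  assumes "t \<in> {0..T}"
  shows "u t \<le> u T"
proof -
  have T: "T \<in> {0..T}" using assms by simp
  have "0 \<le> u0 * b / a" using a b u0 by simp
  then have "w t \<le> w T" unfolding w_def using a assms by (intro mult_left_mono) auto
  moreover have "exp (a * t) \<le> exp (a * T)" using a assms by simp
  ultimately show ?thesis
    unfolding u_def using u0 w_bounds(2)[OF T] by (intro frac_le mult_left_mono) auto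
qed

lemma u_zero: "u 0 = u0"
  by (simp add: u_def w_def)

lemma u_deriv:
  assumes "t \<in> {0..T}"
  shows "(u has_real_derivative a * u t + b * (u t)\<^sup>2) (at t within X)"
proof -
  have ne: "1 - w t \<noteq> 0" using w_bounds[OF assms] by simp
  have "(u has_real_derivative
     (u0 * (exp (a * t) * a) * (1 - w t) - u0 * exp (a * t) * (- (u0 * b * exp (a * t)))) / ((1 - w t) * (1 - w t)))
     (at t within X)"
    unfolding u_def using ne
    by (auto intro!: derivative_eq_intros w_deriv simp: algebra_simps)
  also have "(u0 * (exp (a * t) * a) * (1 - w t) - u0 * exp (a * t) * (- (u0 * b * exp (a * t)))) / ((1 - w t) * (1 - w t))
     = a * u t + b * (u t)\<^sup>2"
  proof -
    have "(u0 * (e * a) * d - u0 * e * (- (u0 * b * e))) / (d * d) = a * (u0 * e / d) + b * (u0 * e / d)\<^sup>2"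
      if "d \<noteq> 0" for d e
      using that by (simp add: power2_eq_square field_simps)
    from this[OF ne] show ?thesis by (simp only: u_def)
  qed
  finally show ?thesis .
qed

lemma u_power_deriv:
  assumes "t \<in> {0..T}"
  shows "((\<lambda>s. u s ^ i) has_real_derivative real i * a * u t ^ i + real i * b * u t ^ (i + 1)) (at t within X)"
proof (cases i)
  case (Suc j)
  show ?thesis
    by (rule DERIV_cong[OF DERIV_power[OF u_deriv[OF assms]]])
       (simp add: Suc power2_eq_square algebra_simps)
qed simp

lemma truncated_zero:
  assumes "1 \<le> i" "i \<le> N"
  shows "truncated N i 0 = u0 ^ i"
proof -
  have "Suc N - i = Suc (N - i)" using assms by simp
  then show ?thesis by (simp add: truncated_def w_def sum.lessThan_Suc_shift)
qed

lemma truncated_Suc_N: "truncated N (Suc N) t = 0"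
  by (simp add: truncated_def)

text \<open>Since \<open>w' = u0 b e\<^sup>a\<^sup>t\<close>, differentiating the sum lowers its degree by one and adds one factor
  \<open>u0 e\<^sup>a\<^sup>t\<close>, which is what level \<open>i + 1\<close> requires. The coefficients match by
  $(k+1) \binom{i+k}{k+1} = i \binom{i+k}{k}$. For \<open>i = N\<close> the last term vanishes, so this is the
  truncated system for all levels at once.\<close>

lemma truncated_deriv:
  assumes i: "1 \<le> i" "i \<le> N"
  shows "(truncated N i has_real_derivative
     real i * a * truncated N i t + real i * b * truncated N (i + 1) t) (at t within X)"
proof -
  define M where "M = N - i"
  have M: "Suc N - i = Suc M" "Suc N - (i + 1) = M" using i by (auto simp: M_def)
  define c where "c = (\<lambda>i k. real ((i + k - 1) choose k))"
  have c: "c i (Suc k) * (1 + real k) = real i * c (i + 1) k" for k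
  proof -
    obtain l where l: "i = Suc l" using i(1) by (cases i) auto
    have "Suc k * (Suc (l + k) choose Suc k) = Suc l * (Suc (l + k) choose k)"
      using binomial_absorption[of k "Suc (l + k)"] binomial_absorb_comp[of "Suc (l + k)" k] by simp
    then have "real (Suc k) * real (Suc (l + k) choose Suc k) = real (Suc l) * real (Suc (l + k) choose k)"
      by (metis of_nat_mult)
    then show ?thesis by (simp add: c_def l algebra_simps)
  qed
  let ?E = "u0 ^ i * exp (a * t) ^ i"
  let ?S = "\<lambda>t. \<Sum>k<Suc M. c i k * w t ^ k"
  have S': "(?S has_real_derivative (\<Sum>k<Suc M. c i k * (real k * w t ^ (k - 1) * (u0 * b * exp (a * t))))) (at t within X)"
    by (auto intro!: derivative_eq_intros w_deriv sum.cong simp: mult_ac)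
  have "(\<Sum>k<Suc M. c i k * (real k * w t ^ (k - 1) * (u0 * b * exp (a * t))))
      = (\<Sum>k<M. (c i (Suc k) * (1 + real k)) * w t ^ k) * (u0 * b * exp (a * t))"
    by (subst sum.lessThan_Suc_shift) (simp add: sum_distrib_right sum_distrib_left mult_ac)
  also have "\<dots> = real i * (\<Sum>k<M. c (i + 1) k * w t ^ k) * (u0 * b * exp (a * t))"
    by (simp only: c sum_distrib_left mult.assoc)
  finally have S'': "(?S has_real_derivative
      real i * (\<Sum>k<M. c (i + 1) k * w t ^ k) * (u0 * b * exp (a * t))) (at t within X)"
    using S' by simp
  have "((\<lambda>t. exp (a * t)) has_real_derivative a * exp (a * t)) (at t within X)"
    by (auto intro!: derivative_eq_intros)
  from DERIV_cmult[OF DERIV_power[OF this, of i], of "u0 ^ i"]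
  have E': "((\<lambda>t. u0 ^ i * exp (a * t) ^ i) has_real_derivative real i * a * ?E) (at t within X)"
    by (rule DERIV_cong) (use i(1) in \<open>cases i; simp\<close>)
  have tr: "truncated N i = (\<lambda>t. u0 ^ i * exp (a * t) ^ i * ?S t)"
    "truncated N (i + 1) t = u0 ^ (i + 1) * exp (a * t) ^ (i + 1) * (\<Sum>k<M. c (i + 1) k * w t ^ k)"
    unfolding truncated_def c_def M by (rule ext refl)+
  have "(real i * a * ?E) * S + (real i * S1 * (u0 * b * exp (a * t))) * ?E
      = real i * a * (?E * S) + real i * b * (u0 ^ (i + 1) * exp (a * t) ^ (i + 1) * S1)" for S S1 :: real
    by (simp add: mult_ac)
  then show ?thesis unfolding tr by (rule DERIV_cong[OF DERIV_mult[OF E' S'']])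
qed

text \<open>On the first level all binomial coefficients are one, and the error is the tail of a geometric
  series.\<close>

lemma u_minus_truncated_one:
  assumes "t \<in> {0..T}"
  shows "u t - truncated N 1 t = u0 * exp (a * t) / (1 - w t) * w t ^ N"
proof -
  have ne: "1 - w t \<noteq> 0" using w_bounds[OF assms] by simp
  have "(\<Sum>k<N. w t ^ k) = (1 - w t ^ N) / (1 - w t)"
    using ne by (simp add: sum_gp_strict)
  then have "truncated N 1 t = u0 * exp (a * t) * ((1 - w t ^ N) / (1 - w t))"
    by (simp add: truncated_def)
  moreover have "p / d - p * ((1 - q) / d) = p / d * q" for p q d :: real
    by (simp add: diff_divide_distrib right_diff_distrib)
  ultimately show ?thesis by (simp only: u_def)
qed

end

section \<open>Comparison of the quadratic system with the scalar equation\<close>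

locale carleman_majorant = scalar_majorant a b u0 T for a b u0 T +
  fixes n :: nat and F1 F2 :: "real mat" and x0 :: "real vec" and I :: "real set"
    and x :: "real \<Rightarrow> real vec"
  assumes n: "0 < n" and F1: "F1 \<in> carrier_mat n n" and F2: "F2 \<in> carrier_mat n (n ^ 2)"
    and F1_le: "sup_norm_mat F1 \<le> a" and F2_le: "sup_norm_mat F2 \<le> b" and x0_le: "sup_norm_vec x0 \<le> u0"
    and I: "{0..T} \<subseteq> I" and sol: "quadratic_ode_solution n F1 F2 x0 I x"
begin

lemma dim_x: "t \<in> {0..T} \<Longrightarrow> dim_vec (x t) = n"
  using sol I by (auto simp: quadratic_ode_solution_def)

text \<open>As long as the components of \<open>x\<close> are at most \<open>r\<close> in absolute value, those of \<open>x'\<close> are at most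
  \<open>a r + b r\<^sup>2\<close>. For \<open>r = u + h\<close> with \<open>h \<le> 1\<close> this exceeds \<open>u'\<close> by at most
  \<open>(a + b (2 u + 1)) h\<close>, and \<open>u \<le> u(T)\<close> gives a constant \<open>L\<close>.\<close>

lemma solution_le_majorant:
  assumes k: "k < n" and t: "t \<in> {0..T}"
  shows "\<bar>x t $ k\<bar> \<le> u t"
proof (rule comparison_principle[where z = "\<lambda>k t. x t $ k" and v = u and m = n and T = T
      and z' = "\<lambda>k t. (F1 *\<^sub>v x t + F2 *\<^sub>v kron_pow_vec (x t) 2) $ k"
      and v' = "\<lambda>t. a * u t + b * (u t)\<^sup>2" and L = "a + b * (2 * u T + 1)"])
  fix k t assume k: "k < n" and t: "t \<in> {0..T}"
  have "((\<lambda>s. x s $ k) has_real_derivative (F1 *\<^sub>v x t + F2 *\<^sub>v kron_pow_vec (x t) 2) $ k) (at t within I)"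
    using sol t I k F2 unfolding quadratic_ode_solution_def has_vec_deriv_def
    by (auto simp: carrier_matD(1))
  then show "((\<lambda>s. x s $ k) has_real_derivative (F1 *\<^sub>v x t + F2 *\<^sub>v kron_pow_vec (x t) 2) $ k) (at t within {0..T})"
    using I by (rule DERIV_subset)
next
  fix t assume "t \<in> {0..T}"
  then show "(u has_real_derivative a * u t + b * (u t)\<^sup>2) (at t within {0..T})" by (rule u_deriv)
next
  fix k assume "k < n"
  moreover have "0 \<in> {0..T}" "x 0 = x0" using t sol by (auto simp: quadratic_ode_solution_def)
  ultimately show "\<bar>x 0 $ k\<bar> \<le> u 0"
    using abs_index_le_sup_norm[of k x0] x0_le dim_x[of 0] by (simp add: u_zero)
next
  have "0 \<le> u T" using t by (intro u_nonneg) simp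
  then show "0 \<le> a + b * (2 * u T + 1)" using a b by simp
next
  fix t h :: real and k :: nat
  assume k: "k < n" and t: "t \<in> {0..T}" and h: "0 < h" "h \<le> 1"
    and le: "\<forall>j<n. \<bar>x t $ j\<bar> \<le> u t + h"
  have nonneg: "0 \<le> u t + h" using u_nonneg[OF t] h by simp
  have "abs_row_sum F1 k \<le> a" "abs_row_sum F2 k \<le> b"
    using abs_row_sum_le_sup_norm[of k F1] abs_row_sum_le_sup_norm[of k F2] k F1 F2 F1_le F2_le by auto
  then have "\<bar>(F1 *\<^sub>v x t) $ k\<bar> \<le> a * (u t + h)"
    and "\<bar>(F2 *\<^sub>v kron_pow_vec (x t) 2) $ k\<bar> \<le> b * (u t + h) ^ 2"
    using abs_mult_mat_vec_le[of k F1 "x t" a "u t + h"] abs_mult_mat_vec_le[of k F2 "kron_pow_vec (x t) 2" b "(u t + h)\<^sup>2"]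
      abs_kron_pow_vec_le[of "x t" "u t + h" _ 2] k F1 F2 dim_x[OF t] le nonneg by auto
  moreover have "(F1 *\<^sub>v x t + F2 *\<^sub>v kron_pow_vec (x t) 2) $ k
      = (F1 *\<^sub>v x t) $ k + (F2 *\<^sub>v kron_pow_vec (x t) 2) $ k"
    using k F2 by (intro index_add_vec) simp
  ultimately have "\<bar>(F1 *\<^sub>v x t + F2 *\<^sub>v kron_pow_vec (x t) 2) $ k\<bar> \<le> a * (u t + h) + b * (u t + h)\<^sup>2"
    by linarith
  also have "\<dots> = a * u t + b * (u t)\<^sup>2 + (a + b * (2 * u t + h)) * h"
    by (simp add: power2_eq_square algebra_simps)
  also have "\<dots> \<le> a * u t + b * (u t)\<^sup>2 + (a + b * (2 * u T + 1)) * h"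
    using u_le[OF t] h b by (intro add_left_mono mult_right_mono mult_left_mono) auto
  finally show "\<bar>(F1 *\<^sub>v x t + F2 *\<^sub>v kron_pow_vec (x t) 2) $ k\<bar>
      \<le> a * u t + b * (u t)\<^sup>2 + (a + b * (2 * u T + 1)) * h" .
qed (use k t in auto)

text \<open>Prolonging the truncated system by zero lets the last equation have the same form as the others.\<close>

definition extended :: "nat \<Rightarrow> (nat \<Rightarrow> real \<Rightarrow> real vec) \<Rightarrow> nat \<Rightarrow> real \<Rightarrow> real vec" where
  "extended N y i t = (if i \<le> N then y i t else 0\<^sub>v (n ^ i))"

lemma transfer_mat_carrier:
  "transfer_mat n F 1 i \<in> carrier_mat (n ^ i) (n ^ i)"
  "transfer_mat n F 2 i \<in> carrier_mat (n ^ i) (n ^ (i + 1))"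
  by (rule carrier_matI; simp)+

lemma extended_carrier:
  assumes "carleman_solution n F1 F2 x0 I N y" "1 \<le> i" "t \<in> {0..T}"
  shows "extended N y i t \<in> carrier_vec (n ^ i)"
  using assms I by (auto simp: extended_def carleman_solution_def)

lemma extended_has_derivative:
  assumes y: "carleman_solution n F1 F2 x0 I N y" and i: "1 \<le> i" "i \<le> N"
    and t: "t \<in> {0..T}" and r: "r < n ^ i"
  shows "((\<lambda>s. extended N y i s $ r) has_real_derivative
     (transfer_mat n F1 1 i *\<^sub>v extended N y i t + transfer_mat n F2 2 i *\<^sub>v extended N y (i + 1) t) $ r)
     (at t within {0..T})"
proof -
  let ?A1 = "transfer_mat n F1 1 i" and ?A2 = "transfer_mat n F2 2 i"
  have y': "((\<lambda>s. y i s $ r) has_real_derivative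
     (?A1 *\<^sub>v extended N y i t + ?A2 *\<^sub>v extended N y (i + 1) t) $ r) (at t within I)"
  proof (cases "i = N")
    case True
    have "?A2 *\<^sub>v 0\<^sub>v (n ^ (i + 1)) = 0\<^sub>v (n ^ i)"
      by (rule eq_vecI) (simp_all add: scalar_prod_def)
    moreover have "?A1 *\<^sub>v y i t + 0\<^sub>v (n ^ i) = ?A1 *\<^sub>v y i t"
      using transfer_mat_carrier(1)
      by (intro right_zero_vec mult_mat_vec_carrier carrier_vecI) simp_all
    ultimately have "?A1 *\<^sub>v extended N y i t + ?A2 *\<^sub>v extended N y (i + 1) t = ?A1 *\<^sub>v y i t"
      using True by (simp add: extended_def)
    moreover have "has_vec_deriv (y i) (?A1 *\<^sub>v y i t) t I"
      using y t I True unfolding carleman_solution_def by auto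
    ultimately show ?thesis using r by (simp add: has_vec_deriv_def del: index_mult_mat_vec)
  next
    case False
    then have "has_vec_deriv (y i) (?A1 *\<^sub>v y i t + ?A2 *\<^sub>v y (i + 1) t) t I"
      using y t i I unfolding carleman_solution_def by auto
    then show ?thesis
      using False i r by (simp add: has_vec_deriv_def extended_def)
  qed
  have eq: "(\<lambda>s. extended N y i s $ r) = (\<lambda>s. y i s $ r)" using i by (simp add: extended_def)
  show ?thesis unfolding eq by (rule DERIV_subset[OF y' I])
qed

text \<open>Downward induction on the level. At level \<open>N + 1\<close> the error is \<open>x\<^sup>[\<^sup>N\<^sup>+\<^sup>1\<^sup>]\<close> itself, at most
  \<open>u\<^sup>N\<^sup>+\<^sup>1\<close>. At level \<open>i\<close> the error solves a linear equation driven by the error of level \<open>i + 1\<close>, and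
  the scalar error solves the same equation with the matrices replaced by their norm bounds.\<close>

lemma carleman_error_le_majorant:
  assumes y: "carleman_solution n F1 F2 x0 I N y" and i: "1 \<le> i" "i \<le> N + 1"
    and t: "t \<in> {0..T}" and r: "r < n ^ i"
  shows "\<bar>kron_pow_vec (x t) i $ r - extended N y i t $ r\<bar> \<le> u t ^ i - truncated N i t"
  using i(2,1) t r
proof (induction i arbitrary: t r rule: inc_induct)
  case base
  have "\<bar>kron_pow_vec (x t) (N + 1) $ r\<bar> \<le> u t ^ (N + 1)"
    by (rule abs_kron_pow_vec_le) (use base dim_x solution_le_majorant in auto)
  moreover have "extended N y (N + 1) t $ r = 0" using base by (simp add: extended_def)
  ultimately show ?case by (simp only: truncated_Suc_N Suc_eq_plus1[symmetric] diff_zero)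
next
  case (step i)
  let ?A1 = "transfer_mat n F1 1 i" and ?A2 = "transfer_mat n F2 2 i"
  let ?v = "\<lambda>i t. u t ^ i - truncated N i t"
  define D where "D = (\<lambda>i t. kron_pow_vec (x t) i - extended N y i t)"
  have i: "1 \<le> i" "i \<le> N" using step by auto
  have dimY: "dim_vec (extended N y j t) = n ^ j" if "t \<in> {0..T}" "1 \<le> j" for j t
    using extended_carrier[OF y that(2,1)] by simp
  have dimD: "dim_vec (D j t) = n ^ j" if "t \<in> {0..T}" "1 \<le> j" for j t
    using dimY[OF that] by (simp add: D_def)
  have D_index: "D j t $ r = kron_pow_vec (x t) j $ r - extended N y j t $ r"
    if "t \<in> {0..T}" "1 \<le> j" "r < n ^ j" for j t r
    using dimY[OF that(1,2)] that(3) by (simp add: D_def)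
  have D_next: "\<bar>D (i + 1) t $ r\<bar> \<le> ?v (i + 1) t" if "t \<in> {0..T}" "r < n ^ (i + 1)" for t r
    using step.IH[of t r] D_index[of t "i + 1" r] that by simp
  \<comment> \<open>The bound at level \<open>i + 1\<close> is nonnegative because it bounds the absolute value of an entry, and
    \<open>n > 0\<close> provides one.\<close>
  have v_next: "0 \<le> ?v (i + 1) t" if "t \<in> {0..T}" for t
    using D_next[OF that, of 0] n by (meson abs_ge_zero order_trans zero_less_power)
  have "\<bar>kron_pow_vec (x t) i $ r - extended N y i t $ r\<bar> \<le> ?v i t"
  proof (rule comparison_principle[where z = "\<lambda>r t. kron_pow_vec (x t) i $ r - extended N y i t $ r"
        and v = "?v i" and m = "n ^ i" and T = T
        and z' = "\<lambda>r t. (?A1 *\<^sub>v D i t) $ r + (?A2 *\<^sub>v D (i + 1) t) $ r"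
        and v' = "\<lambda>t. real i * a * ?v i t + real i * b * ?v (i + 1) t" and L = "real i * a"])
    fix r t assume r: "r < n ^ i" and t: "t \<in> {0..T}"
    let ?x = "kron_pow_vec (x t)" and ?y = "\<lambda>i. extended N y i t"
    have car: "?x j \<in> carrier_vec (n ^ j)" for j
      using dim_x[OF t] by (intro carrier_vecI) simp
    note A1 = mult_minus_distrib_mat_vec[OF transfer_mat_carrier(1) car extended_carrier[OF y i(1) t], of F1]
    note A2 = mult_minus_distrib_mat_vec[OF transfer_mat_carrier(2) car extended_carrier[OF y _ t], of i F2]
    have eq: "(?A1 *\<^sub>v D i t) $ r + (?A2 *\<^sub>v D (i + 1) t) $ r
        = (?A1 *\<^sub>v ?x i + ?A2 *\<^sub>v ?x (i + 1)) $ r - (?A1 *\<^sub>v ?y i + ?A2 *\<^sub>v ?y (i + 1)) $ r"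
      using r A1 A2 by (simp add: D_def del: index_mult_mat_vec kron_pow_vec.simps One_nat_def)
    show "((\<lambda>t. kron_pow_vec (x t) i $ r - extended N y i t $ r) has_real_derivative
        (?A1 *\<^sub>v D i t) $ r + (?A2 *\<^sub>v D (i + 1) t) $ r) (at t within {0..T})"
      unfolding eq using I t
      by (intro DERIV_diff extended_has_derivative[OF y i t r]
          DERIV_subset[OF kron_pow_solution_has_derivative[OF F1 F2 sol _ r]]) auto
  next
    fix t assume t: "t \<in> {0..T}"
    show "(?v i has_real_derivative real i * a * ?v i t + real i * b * ?v (i + 1) t) (at t within {0..T})"
      by (rule DERIV_cong[OF DERIV_diff[OF u_power_deriv[OF t] truncated_deriv[OF i]]])
        (simp add: algebra_simps)
  next
    fix r assume r: "r < n ^ i"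
    have "x 0 = x0" "y i 0 = kron_pow_vec x0 i"
      using sol y i by (auto simp: quadratic_ode_solution_def carleman_solution_def)
    then show "\<bar>kron_pow_vec (x 0) i $ r - extended N y i 0 $ r\<bar> \<le> ?v i 0"
      using i by (simp add: extended_def u_zero truncated_zero)
  next
    fix r t and h :: real
    assume r: "r < n ^ i" and t: "t \<in> {0..T}" and h: "0 < h"
      and le: "\<forall>j<n ^ i. \<bar>kron_pow_vec (x t) i $ j - extended N y i t $ j\<bar> \<le> ?v i t + h"
    have le: "\<bar>D i t $ j\<bar> \<le> ?v i t + h" if "j < n ^ i" for j
      using le that i D_index[OF t i(1)] by simp
    have nonneg: "0 \<le> ?v i t + h" using le[OF r] by (rule order_trans[OF abs_ge_zero])
    have "real i * sup_norm_mat F1 \<le> real i * a" "real i * sup_norm_mat F2 \<le> real i * b"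
      using F1_le F2_le by (intro mult_left_mono; simp)+
    then have S: "abs_row_sum ?A1 r \<le> real i * a" "abs_row_sum ?A2 r \<le> real i * b"
      using abs_row_sum_transfer_mat[of 1 F1 n r i] abs_row_sum_transfer_mat[of 2 F2 n r i] F1 F2 r
      by (simp, linarith?)+
    have "\<bar>(?A1 *\<^sub>v D i t) $ r\<bar> \<le> real i * a * (?v i t + h)"
      by (rule abs_mult_mat_vec_le[OF _ _ S(1) _ nonneg]) (use r le dimD[OF t i(1)] in auto)
    moreover have "\<bar>(?A2 *\<^sub>v D (i + 1) t) $ r\<bar> \<le> real i * b * ?v (i + 1) t"
      by (rule abs_mult_mat_vec_le[OF _ _ S(2) _ v_next[OF t]])
        (use r D_next[OF t] dimD[OF t, of "i + 1"] in auto)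
    ultimately show "\<bar>(?A1 *\<^sub>v D i t) $ r + (?A2 *\<^sub>v D (i + 1) t) $ r\<bar>
        \<le> real i * a * ?v i t + real i * b * ?v (i + 1) t + real i * a * h"
      unfolding distrib_left by linarith
  qed (use step.prems a in auto)
  then show ?case .
qed

lemma first_component_error:
  assumes y: "carleman_solution n F1 F2 x0 I N y" and N: "1 \<le> N" and t: "t \<in> {0..T}"
  shows "sup_norm_vec (x t - y 1 t) \<le> u0 * exp (a * t) / (1 - w t) * w t ^ N"
proof (rule sup_norm_vec_le)
  have dy: "dim_vec (y 1 t) = n"
    using extended_carrier[OF y _ t, of 1] N by (simp add: extended_def)
  then show "0 < dim_vec (x t - y 1 t)" using n by simp
  fix k assume "k < dim_vec (x t - y 1 t)"
  with dy have k: "k < n" by simp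
  have "\<bar>kron_pow_vec (x t) 1 $ k - extended N y 1 t $ k\<bar> \<le> u t ^ 1 - truncated N 1 t"
    using k by (intro carleman_error_le_majorant[OF y _ _ t]) auto
  then have "\<bar>x t $ k - y 1 t $ k\<bar> \<le> u t - truncated N 1 t"
    unfolding kron_pow_vec_one using N by (simp add: extended_def)
  then show "\<bar>(x t - y 1 t) $ k\<bar> \<le> u0 * exp (a * t) / (1 - w t) * w t ^ N"
    using k dy u_minus_truncated_one[OF t, of N] by simp
qed

end

section \<open>The error estimate\<close>

text \<open>For \<open>\<beta>\<^sub>0 > 0\<close> the time $T^*$ is where \<open>\<beta>\<^sub>0 (e\<^sup>a\<^sup>t - 1)\<close> reaches one, the blow-up time of the
  scalar solution; for \<open>\<beta>\<^sub>0 = 0\<close> there is no blow-up.\<close>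

lemma before_Tstar:
  assumes a: "0 < sup_norm_mat F1" and \<beta>: "0 \<le> carleman_beta0 F1 F2 x0"
    and T: "ereal T < carleman_Tstar F1 F2 x0"
  shows "carleman_beta0 F1 F2 x0 * (exp (sup_norm_mat F1 * T) - 1) < 1"
proof (cases "carleman_beta0 F1 F2 x0 = 0")
  case False
  let ?a = "sup_norm_mat F1" and ?\<beta> = "carleman_beta0 F1 F2 x0"
  have pos: "0 < ?\<beta>" using False \<beta> by simp
  have "T < 1 / ?a * ln (1 + 1 / ?\<beta>)"
    using T False by (simp add: carleman_Tstar_def Let_def)
  then have "?a * T < ln (1 + 1 / ?\<beta>)" using a by (simp add: field_simps)
  then have "exp (?a * T) < exp (ln (1 + 1 / ?\<beta>))" by (simp only: exp_less_mono)
  then have "exp (?a * T) - 1 < 1 / ?\<beta>" using pos by (simp add: add_pos_pos)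
  then show ?thesis using pos by (simp add: field_simps)
qed simp

theorem theorem4p3:
  fixes n :: nat and F1 F2 :: "real mat" and x0 :: "real vec"
    and I :: "real set" and x :: "real \<Rightarrow> real vec"
  assumes n: "n \<ge> 1"
    and I: "is_interval I" "I \<subseteq> {0..}" "0 \<in> I"
    and F1: "F1 \<in> carrier_mat n n" "sup_norm_mat F1 \<noteq> 0"
    and F2: "F2 \<in> carrier_mat n (n ^ 2)"
    and x: "quadratic_ode_solution n F1 F2 x0 I x"
  shows "(\<forall>N\<ge>1. \<forall>y. carleman_solution n F1 F2 x0 I N y \<longrightarrow>
            (\<forall>t\<in>I. ereal t < carleman_Tstar F1 F2 x0 \<longrightarrow>
               sup_norm_vec (x t - y 1 t) \<le> carleman_E2 F1 F2 x0 N t))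
       \<and> (\<forall>Y. (\<forall>N\<ge>1. carleman_solution n F1 F2 x0 I N (Y N)) \<longrightarrow>
            (\<forall>t\<in>I. ereal t < carleman_Tstar F1 F2 x0 \<longrightarrow>
               (\<lambda>N. sup_norm_vec (x t - Y N 1 t)) \<longlonglongrightarrow> 0))"
proof -
  let ?a = "sup_norm_mat F1" and ?b = "sup_norm_mat F2" and ?u0 = "sup_norm_vec x0"
  let ?\<beta> = "carleman_beta0 F1 F2 x0"
  have a: "0 < ?a" using sup_norm_mat_nonneg[of F1] F1 n by simp
  have b: "0 \<le> ?b" using sup_norm_mat_nonneg[of F2] F2 n by simp
  have "x0 \<in> carrier_vec n" using x I(3) by (auto simp: quadratic_ode_solution_def)
  then have u0: "0 \<le> ?u0" using sup_norm_vec_nonneg[of x0] n by simp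
  have \<beta>: "0 \<le> ?\<beta>" using a b u0 by (simp add: carleman_beta0_def)
  have majorant: "carleman_majorant ?a ?b ?u0 t n F1 F2 x0 I x"
    if t: "t \<in> I" "ereal t < carleman_Tstar F1 F2 x0" for t
  proof unfold_locales
    show "?u0 * ?b / ?a * (exp (?a * t) - 1) < 1"
      using before_Tstar[OF a \<beta> t(2)] by (simp add: carleman_beta0_def)
    show "{0..t} \<subseteq> I" using mem_is_interval_1_I[OF I(1) I(3) t(1)] by auto
  qed (use a b u0 n F1 F2 x in auto)
  have bound: "sup_norm_vec (x t - y 1 t) \<le> carleman_E2 F1 F2 x0 N t"
    if N: "1 \<le> N" and y: "carleman_solution n F1 F2 x0 I N y"
      and t: "t \<in> I" "ereal t < carleman_Tstar F1 F2 x0" for N y t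
  proof -
    have t': "t \<in> {0..t}" using t(1) I(2) by auto
    interpret carleman_majorant ?a ?b ?u0 t n F1 F2 x0 I x by (rule majorant[OF t])
    have w: "w t = ?\<beta> * (exp (?a * t) - 1)" by (simp add: w_def carleman_beta0_def)
    have w1: "1 - w t = (1 + ?\<beta>) - ?\<beta> * exp (?a * t)" by (simp add: w right_diff_distrib)
    show ?thesis
      using first_component_error[OF y N t'] unfolding w1 unfolding carleman_E2_def Let_def w .
  qed
  have "(\<lambda>N. sup_norm_vec (x t - Y N 1 t)) \<longlonglongrightarrow> 0"
    if Y: "\<forall>N\<ge>1. carleman_solution n F1 F2 x0 I N (Y N)"
      and t: "t \<in> I" "ereal t < carleman_Tstar F1 F2 x0" for Y t
  proof (rule tendsto_sandwich[of "\<lambda>_. 0" _ _ "\<lambda>N. carleman_E2 F1 F2 x0 N t"])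
    have "0 \<le> t" using t(1) I(2) by auto
    have "0 \<le> ?\<beta> * (exp (?a * t) - 1)"
      using \<beta> a \<open>0 \<le> t\<close> by (intro mult_nonneg_nonneg) auto
    then have "(\<lambda>N. (?\<beta> * (exp (?a * t) - 1)) ^ N) \<longlonglongrightarrow> 0"
      using before_Tstar[OF a \<beta> t(2)] by (intro LIMSEQ_power_zero) simp
    then show "(\<lambda>N. carleman_E2 F1 F2 x0 N t) \<longlonglongrightarrow> 0"
      unfolding carleman_E2_def Let_def by (rule tendsto_mult_right_zero)
    have "0 \<le> sup_norm_vec (x t - Y N 1 t)" if "1 \<le> N" for N
    proof -
      have "Y N 1 t \<in> carrier_vec (n ^ 1)"
        using Y that t(1) unfolding carleman_solution_def by (meson atLeastAtMost_iff order_refl)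
      then show ?thesis using n by (intro sup_norm_vec_nonneg) simp
    qed
    then show "\<forall>\<^sub>F N in sequentially. 0 \<le> sup_norm_vec (x t - Y N 1 t)"
      by (rule eventually_sequentiallyI)
    show "\<forall>\<^sub>F N in sequentially. sup_norm_vec (x t - Y N 1 t) \<le> carleman_E2 F1 F2 x0 N t"
      using bound Y t by (intro eventually_sequentiallyI[of 1]) auto
  qed simp
  with bound show ?thesis by blast
qed

end
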